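(* For all integers $m,n\ge 3$, the $m\times n$ grid graph $\mathrm{Gr}_{m,n}$ has representation number $\mathcal{R}(\mathrm{Gr}_{m,n})=3$.
   Context: The grid graph $\mathrm{Gr}_{m,n}$ has vertex set $\{x_{i,j} : 1\le i\le m,\ 1\le j\le n\}$ and edge set $\{x_{i,j}x_{i,j+1} : 1\le i\le m,\ 1\le j\le n-1\}\cup\{x_{i,j}x_{i+1,j} : 1\le i\le m-1,\ 1\le j\le n\}$ (the Cartesian product of the paths $P_m$ and $P_n$). Two distinct letters $x,y$ alternate in a word $w$ if, after deleting all other letters from $w$, the remaining word has the form $xyxy\cdots$ or $yxyx\cdots$ (of even or odd length). A word $w$ over the alphabet $V$, in which every letter of $V$ occurs, represents a simple graph $G=(V,E)$ if for all distinct $x,y\in V$, $x$ and $y$ alternate in $w$ if and only if $xy\in E$. A graph is word-representable if some word represents it. It is $k$-representable if it is represented by a word in which each letter of $V$ occurs exactly $k$ times. Every word-representable graph is $k$-representable for some $k\geq 1$; the representation number $\mathcal{R}(G)$ is the minimum such $k$, with $\mathcal{R}(G)=\infty$ if $G$ is not word-representable. *)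

theory Defs
  imports Main "HOL-Library.Extended_Nat"
begin

text \<open>A simple graph is given by its vertex set and its set of two-element edges.\<close>

definition simple_graph :: "'a set \<Rightarrow> 'a set set \<Rightarrow> bool" where
  "simple_graph V E \<longleftrightarrow> (\<forall>e\<in>E. e \<subseteq> V \<and> card e = 2)"

definition grid_verts :: "nat \<Rightarrow> nat \<Rightarrow> (nat \<times> nat) set" where
  "grid_verts m n = {1..m} \<times> {1..n}"

definition grid_edges :: "nat \<Rightarrow> nat \<Rightarrow> (nat \<times> nat) set set" where
  "grid_edges m n =
     {{(i, j), (i, j + 1)} | i j. 1 \<le> i \<and> i \<le> m \<and> 1 \<le> j \<and> j \<le> n - 1} \<union>
     {{(i, j), (i + 1, j)} | i j. 1 \<le> i \<and> i \<le> m - 1 \<and> 1 \<le> j \<and> j \<le> n}"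

lemma simple_graph_grid: "simple_graph (grid_verts m n) (grid_edges m n)"
  by (auto simp: simple_graph_def grid_verts_def grid_edges_def)

fun alt_word :: "'a \<Rightarrow> 'a \<Rightarrow> nat \<Rightarrow> 'a list" where
  "alt_word x y 0 = []"
| "alt_word x y (Suc l) = x # alt_word y x l"

definition alternate :: "'a list \<Rightarrow> 'a \<Rightarrow> 'a \<Rightarrow> bool" where
  "alternate w x y \<longleftrightarrow>
     (\<exists>l. filter (\<lambda>z. z = x \<or> z = y) w = alt_word x y l \<or>
          filter (\<lambda>z. z = x \<or> z = y) w = alt_word y x l)"

definition represents :: "'a list \<Rightarrow> 'a set \<Rightarrow> 'a set set \<Rightarrow> bool" where
  "represents w V E \<longleftrightarrow>
     set w = V \<and> (\<forall>x\<in>V. \<forall>y\<in>V. x \<noteq> y \<longrightarrow> (alternate w x y \<longleftrightarrow> {x, y} \<in> E))"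

definition word_representable :: "'a set \<Rightarrow> 'a set set \<Rightarrow> bool" where
  "word_representable V E \<longleftrightarrow> (\<exists>w. represents w V E)"

definition k_representable :: "nat \<Rightarrow> 'a set \<Rightarrow> 'a set set \<Rightarrow> bool" where
  "k_representable k V E \<longleftrightarrow> (\<exists>w. represents w V E \<and> (\<forall>x\<in>V. count_list w x = k))"

definition representation_number :: "'a set \<Rightarrow> 'a set set \<Rightarrow> enat" where
  "representation_number V E =
     (if word_representable V E then enat (LEAST k. k \<ge> 1 \<and> k_representable k V E) else \<infinity>)"

end

theory Submission
  imports Defs "HOL-Library.Product_Lexorder"
begin

text \<open>
  Upper bound: a concatenation of three permutations of the vertices makes exactly those pairs
  alternate that occur in the same order in all three. So it suffices that the height-two poset
  which puts the even vertices of the grid below their odd neighbours is an intersection of three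
  linear orders. This is the poset of vertices and faces of a square lattice, for which three
  lexicographic orders do the job.

  Lower bound: in a word in which every letter occurs twice, view the occurrences of a letter as
  the endpoints of a chord; two letters alternate iff their chords cross. In a \<open>3 \<times> 3\<close> subgrid the
  four neighbours of the centre are pairwise non-crossing chords that cross the centre chord, hence
  they are linearly ordered along it. Every corner chord avoids the centre chord, which forces the
  two neighbours it crosses to be consecutive in this order. Thus the four neighbours would be
  cyclically consecutive in a linear order, which is impossible.
\<close>

section \<open>Alternation in a concatenation of three permutations\<close>

lemma length_alt_word [simp]: "length (alt_word x y l) = l"
  by (induction x y l rule: alt_word.induct) auto

text \<open>The restricted word already fixes the length, so the existential disappears and
  alternation becomes a finite check.\<close>

lemma alternate_iff_length:
  assumes "length (filter (\<lambda>z. z = x \<or> z = y) w) = l"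
  shows "alternate w x y \<longleftrightarrow>
    filter (\<lambda>z. z = x \<or> z = y) w = alt_word x y l \<or>
    filter (\<lambda>z. z = x \<or> z = y) w = alt_word y x l"
  using assms unfolding alternate_def by (metis length_alt_word)

lemma filter_pair_sort_key:
  fixes f :: "'a \<Rightarrow> 'b :: linorder"
  assumes "distinct xs" "x \<in> set xs" "y \<in> set xs" "f x < f y"
  shows "filter (\<lambda>z. z = x \<or> z = y) (sort_key f xs) = [x, y]" (is "?l = _")
proof -
  have l: "sorted (map f ?l)" "distinct ?l" "set ?l = {x, y}"
    using assms by (auto simp: sorted_filter)
  then have "length ?l = 2"
    using assms(4) distinct_card[of ?l] by (metis card_2_iff less_irrefl)
  then obtain u v where "?l = [u, v]"
    by (auto simp: length_Suc_conv numeral_2_eq_2 simp del: filter_sort)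
  then show ?thesis
    using l assms(4) by (auto simp: doubleton_eq_iff simp del: filter_sort)
qed

text \<open>Restricted to the two letters, each permutation leaves a block \<open>xy\<close> or
  \<open>yx\<close>; two different neighbouring blocks would repeat a letter.\<close>

lemma alternate_sort_key3_iff:
  fixes f g h :: "'a \<Rightarrow> 'b :: linorder"
  assumes "inj f" "inj g" "inj h" "distinct xs" "x \<in> set xs" "y \<in> set xs" "x \<noteq> y"
  shows "alternate (sort_key f xs @ sort_key g xs @ sort_key h xs) x y \<longleftrightarrow>
    f x < f y \<and> g x < g y \<and> h x < h y \<or> f y < f x \<and> g y < g x \<and> h y < h x"
proof -
  have *: "filter (\<lambda>z. z = x \<or> z = y) (sort_key k xs)
      = (if k x < k y then [x, y] else [y, x])" if "inj k" for k :: "'a \<Rightarrow> 'b"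
  proof (cases "k x < k y")
    case True
    then show ?thesis
      using filter_pair_sort_key[of xs x y k] assms by simp
  next
    case False
    then have "k y < k x"
      using that assms(7) by (metis injD linorder_cases)
    then show ?thesis
      using filter_pair_sort_key[of xs y x k] assms False
      by (simp add: disj_commute)
  qed
  have neq: "f x \<noteq> f y" "g x \<noteq> g y" "h x \<noteq> h y"
    using assms by (auto dest: injD)
  show ?thesis
    by (subst alternate_iff_length[where l = 6])
      (use assms neq in \<open>auto simp: * numeral_eq_Suc simp del: filter_sort\<close>)
qed

section \<open>Three linear orders on the grid vertices\<close>

text \<open>In the coordinates \<open>s = i + j\<close>, \<open>d = i - j\<close> the vertices with \<open>e = 0\<close> form a square lattice and
  those with \<open>e = 1\<close> are the centres of its cells. Lattice points are ordered lexicographically by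
  \<open>(s, -d)\<close>, by \<open>(-s, -d)\<close> and by \<open>(d, s)\<close>; in each order a cell comes right after the last of its
  four corners, respectively, in the third order, after the whole row of its upper corners.\<close>

definition grid_key :: "nat \<Rightarrow> nat \<times> nat \<Rightarrow> int \<times> int" where
  "grid_key k p = (let i = int (fst p); j = int (snd p); s = i + j; d = i - j; e = s mod 2
     in if k = 0 then (s + e, 2 * e - d) else if k = 1 then (e - s, 2 * e - d) else (d + 2 * e, s))"

text \<open>As \<open>s\<close> and \<open>d\<close> have the same parity, the second component of a
  key determines \<open>e\<close>; once \<open>e\<close> is known, the key gives back
  \<open>s\<close> and \<open>d\<close>.\<close>

lemma inj_grid_key: "inj (grid_key k)"
proof (rule injI, clarify)
  fix a b c d :: nat
  assume *: "grid_key k (a, b) = grid_key k (c, d)"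
  define A B C D where "A = int a" "B = int b" "C = int c" "D = int d"
  note ABCD = this
  \<comment> \<open>Naming quotient and remainder turns the parity into linear constraints.\<close>
  define q e where "q = (A + B) div 2" and "e = (A + B) mod 2"
  define r f where "r = (C + D) div 2" and "f = (C + D) mod 2"
  have "A + B = 2 * q + e" "C + D = 2 * r + f" "e = 0 \<or> e = 1" "f = 0 \<or> f = 1"
    unfolding q_def e_def r_def f_def by auto
  moreover have "k = 0 \<and> A + B + e = C + D + f \<and> 2 * e - (A - B) = 2 * f - (C - D) \<or>
      k = 1 \<and> e - (A + B) = f - (C + D) \<and> 2 * e - (A - B) = 2 * f - (C - D) \<or>
      A - B + 2 * e = C - D + 2 * f \<and> A + B = C + D"
    using * unfolding grid_key_def Let_def fst_conv snd_conv ABCD[symmetric]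
      e_def[symmetric] f_def[symmetric] by (simp split: if_splits)
  ultimately have "A = C \<and> B = D"
    by smt
  then show "a = c \<and> b = d"
    by (simp add: ABCD)
qed

lemma all_less_3_iff: "(\<forall>k<3. P k) \<longleftrightarrow> P 0 \<and> P 1 \<and> P (2 :: nat)"
  by (auto simp: numeral_eq_Suc less_Suc_eq)

text \<open>For vertices of equal parity, the first two orders force equal \<open>s\<close> and then
  decreasing \<open>d\<close>, against the third. An odd vertex is never below an even one, by the
  first two orders. An even vertex is below an odd one iff \<open>s\<close> and \<open>d\<close>
  both change by exactly 1, which is a step along one axis.\<close>

lemma grid_key_adjacent:
  fixes a b c d :: nat
  shows "((\<forall>k<3. grid_key k (a, b) < grid_key k (c, d)) \<or>
          (\<forall>k<3. grid_key k (c, d) < grid_key k (a, b))) \<longleftrightarrow>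
    a = c \<and> (d = b + 1 \<or> b = d + 1) \<or> b = d \<and> (c = a + 1 \<or> a = c + 1)"
proof -
  define A B C D where "A = int a" "B = int b" "C = int c" "D = int d"
  note ABCD = this
  define q e where "q = (A + B) div 2" and "e = (A + B) mod 2"
  define r f where "r = (C + D) div 2" and "f = (C + D) mod 2"
  have ef: "A + B = 2 * q + e" "C + D = 2 * r + f" "e = 0 \<or> e = 1" "f = 0 \<or> f = 1"
    unfolding q_def e_def r_def f_def by auto
  have nat: "a = c \<longleftrightarrow> A = C" "b = d \<longleftrightarrow> B = D" "d = b + 1 \<longleftrightarrow> D = B + 1" "b = d + 1 \<longleftrightarrow> B = D + 1"
    "c = a + 1 \<longleftrightarrow> C = A + 1" "a = c + 1 \<longleftrightarrow> A = C + 1"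
    by (auto simp: ABCD)
  have lex: "(u, v) < (u', v') \<longleftrightarrow> u < u' \<or> u = u' \<and> v < v'" for u v u' v' :: int
    by auto
  have "((A + B + e < C + D + f \<or> A + B + e = C + D + f \<and> 2 * e - (A - B) < 2 * f - (C - D)) \<and>
      (e - (A + B) < f - (C + D) \<or>
       e - (A + B) = f - (C + D) \<and> 2 * e - (A - B) < 2 * f - (C - D)) \<and>
      (A - B + 2 * e < C - D + 2 * f \<or> A - B + 2 * e = C - D + 2 * f \<and> A + B < C + D) \<or>
      (C + D + f < A + B + e \<or> C + D + f = A + B + e \<and> 2 * f - (C - D) < 2 * e - (A - B)) \<and>
      (f - (C + D) < e - (A + B) \<or>
       f - (C + D) = e - (A + B) \<and> 2 * f - (C - D) < 2 * e - (A - B)) \<and>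
      (C - D + 2 * f < A - B + 2 * e \<or> C - D + 2 * f = A - B + 2 * e \<and> C + D < A + B)) \<longleftrightarrow>
      A = C \<and> (D = B + 1 \<or> B = D + 1) \<or> B = D \<and> (C = A + 1 \<or> A = C + 1)"
    using ef by smt
  then show ?thesis
    unfolding all_less_3_iff nat unfolding grid_key_def Let_def fst_conv snd_conv ABCD[symmetric]
      e_def[symmetric] f_def[symmetric] by (simp add: lex del: less_prod_simp)
qed

lemma grid_edges_iff:
  assumes "(a, b) \<in> grid_verts m n" "(c, d) \<in> grid_verts m n"
  shows "{(a, b), (c, d)} \<in> grid_edges m n \<longleftrightarrow>
    a = c \<and> (d = b + 1 \<or> b = d + 1) \<or> b = d \<and> (c = a + 1 \<or> a = c + 1)"
  using assms unfolding grid_edges_def grid_verts_def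
  by (auto simp: doubleton_eq_iff) presburger+

lemma count_list_distinct:
  assumes "distinct xs" "x \<in> set xs"
  shows "count_list xs x = 1"
  using assms by (induction xs) auto

lemma grid_3_representable: "k_representable 3 (grid_verts m n) (grid_edges m n)"
proof -
  let ?V = "grid_verts m n"
  have "finite ?V"
    by (simp add: grid_verts_def)
  then obtain xs where xs: "set xs = ?V" "distinct xs"
    using finite_distinct_list by blast
  let ?w = "sort_key (grid_key 0) xs @ sort_key (grid_key 1) xs @ sort_key (grid_key 2) xs"
  have "alternate ?w p q \<longleftrightarrow> {p, q} \<in> grid_edges m n"
    if "p \<in> ?V" "q \<in> ?V" "p \<noteq> q" for p q
    using alternate_sort_key3_iff[OF inj_grid_key inj_grid_key inj_grid_key xs(2), of p q 0 1 2]
      grid_edges_iff[of "fst p" "snd p" m n "fst q" "snd q"]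
      grid_key_adjacent[of "fst p" "snd p" "fst q" "snd q"] that xs
    by (simp add: all_less_3_iff)
  then have "represents ?w ?V (grid_edges m n)"
    unfolding represents_def using xs by auto
  moreover have "\<forall>x\<in>?V. count_list ?w x = 3"
    using xs by (simp add: count_list_distinct)
  ultimately show ?thesis
    unfolding k_representable_def by blast
qed

section \<open>Words in which letters occur once or twice\<close>

lemma alternate_if_count_list_1:
  assumes "count_list w x = 1" "count_list w y = 1" "x \<noteq> y"
  shows "alternate w x y"
proof -
  let ?u = "filter (\<lambda>z. z = x \<or> z = y) w"
  have "count_list ?u z = count_list w z" if "z = x \<or> z = y" for z
    using that by (induction w) auto
  then have u: "count_list ?u x = 1" "count_list ?u y = 1"
    using assms by simp_all
  have "length ?u = count_list w x + count_list w y"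
    using assms(3) by (induction w) auto
  then have "length ?u = 2"
    using assms by simp
  then obtain a b where "?u = [a, b]"
    by (auto simp: length_Suc_conv numeral_2_eq_2)
  with u assms(3) have "?u = alt_word x y 2 \<or> ?u = alt_word y x 2"
    by (auto simp: numeral_2_eq_2 split: if_splits)
  then show ?thesis
    unfolding alternate_def by blast
qed

definition crossing :: "'a \<times> 'a \<Rightarrow> 'a \<times> 'a :: linorder \<Rightarrow> bool" where
  "crossing p q \<longleftrightarrow> fst p < fst q \<and> fst q < snd p \<and> snd p < snd q \<or>
                   fst q < fst p \<and> fst p < snd q \<and> snd q < snd p"

text \<open>The restricted word lists the letters at the four positions in increasing order; it
  alternates exactly for the orders \<open>a c b d\<close> and \<open>c a d b\<close>.\<close>

lemma alternate_iff_crossing: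
  assumes "{i. i < length w \<and> w ! i = x} = {a, b}" "a < b"
    and "{i. i < length w \<and> w ! i = y} = {c, d}" "c < d" and "x \<noteq> y"
  shows "alternate w x y \<longleftrightarrow> crossing (a, b) (c, d)"
proof -
  let ?l = "filter (\<lambda>i. w ! i = x \<or> w ! i = y) [0..<length w]"
  have w: "w ! a = x" "w ! b = x" "w ! c = y" "w ! d = y"
    using assms by blast+
  have "set ?l = {i. i < length w \<and> w ! i = x} \<union> {i. i < length w \<and> w ! i = y}"
    by auto
  then have "set ?l = {a, b, c, d}"
    unfolding assms by auto
  moreover have "sorted ?l" "distinct ?l"
    by (simp_all add: sorted_wrt_filter)
  ultimately have l: "?l = sorted_list_of_set {a, b, c, d}"
    by (metis sorted_list_of_set.idem_if_sorted_distinct)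
  have "filter (\<lambda>z. z = x \<or> z = y) w = map ((!) w) ?l"
    using filter_map[of "\<lambda>z. z = x \<or> z = y" "(!) w" "[0..<length w]"] by (simp add: map_nth o_def)
  then have f: "filter (\<lambda>z. z = x \<or> z = y) w = map ((!) w) (sorted_list_of_set {a, b, c, d})"
    using l by simp
  have d: "a \<noteq> c" "a \<noteq> d" "b \<noteq> c" "b \<noteq> d"
    using w assms(5) by auto
  show ?thesis
    by (subst alternate_iff_length[where l = 4])
      (use assms(2,4,5) d w in \<open>auto simp: f numeral_eq_Suc crossing_def insort_remove1
          sorted_list_of_set.sorted_key_list_of_set_insert_remove insert_Diff_if\<close>)
qed

text \<open>The endpoint of the chord \<open>p\<close> that lies inside the chord \<open>c\<close>, provided that \<open>p\<close> crosses \<open>c\<close>.\<close>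

definition meet :: "'a \<times> 'a \<Rightarrow> 'a \<times> 'a \<Rightarrow> 'a :: linorder" where
  "meet c p = (if fst c < fst p \<and> fst p < snd c then fst p else snd p)"

text \<open>The chord \<open>t\<close> lies on one side of \<open>c\<close>, and the parallel chords \<open>p\<close>, \<open>q\<close>, \<open>r\<close> meet the two arcs
  cut off by \<open>c\<close> in opposite orders; so on either side \<open>t\<close> separates \<open>r\<close> from both \<open>p\<close> and \<open>q\<close>.\<close>

lemma not_between_if_crossing_int:
  fixes c p q r t :: "int \<times> int"
  assumes "fst c < snd c" "fst p < snd p" "fst q < snd q" "fst r < snd r" "fst t < snd t"
    and "crossing c p" "crossing c q" "crossing c r" "\<not> crossing c t"
    and "\<not> crossing p q" "\<not> crossing p r" "\<not> crossing q r"
    and "crossing t p" "crossing t q" "\<not> crossing t r"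
    and "distinct [fst c, snd c, fst p, snd p, fst q, snd q, fst r, snd r, fst t, snd t]"
  shows "\<not> (meet c p < meet c r \<and> meet c r < meet c q)"
  using assms unfolding crossing_def meet_def distinct.simps list.set insert_iff empty_iff
  by (smt (verit))

text \<open>Word positions are natural numbers; the order embedding \<open>int\<close> preserves
  \<open>crossing\<close> and commutes with \<open>meet\<close>.\<close>

lemma not_between_if_crossing:
  fixes c p q r t :: "nat \<times> nat"
  assumes "fst c < snd c" "fst p < snd p" "fst q < snd q" "fst r < snd r" "fst t < snd t"
    and "crossing c p" "crossing c q" "crossing c r" "\<not> crossing c t"
    and "\<not> crossing p q" "\<not> crossing p r" "\<not> crossing q r"
    and "crossing t p" "crossing t q" "\<not> crossing t r"
    and "distinct [fst c, snd c, fst p, snd p, fst q, snd q, fst r, snd r, fst t, snd t]"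
  shows "\<not> (meet c p < meet c r \<and> meet c r < meet c q)"
proof -
  let ?i = "map_prod int int"
  have [simp]: "crossing (?i u) (?i v) \<longleftrightarrow> crossing u v" "meet (?i u) (?i v) = int (meet u v)" for u v
    by (auto simp: crossing_def meet_def)
  show ?thesis
    using not_between_if_crossing_int[of "?i c" "?i p" "?i q" "?i r" "?i t"] assms by simp
qed

lemma grid_not_2_representable:
  assumes "m \<ge> 3" and "n \<ge> 3"
  shows "\<not> k_representable 2 (grid_verts m n) (grid_edges m n)"
proof
  let ?V = "grid_verts m n"
  assume "k_representable 2 ?V (grid_edges m n)"
  then obtain w where w: "represents w ?V (grid_edges m n)" "\<And>x. x \<in> ?V \<Longrightarrow> count_list w x = 2"
    unfolding k_representable_def by blast
  have "\<exists>p. {i. i < length w \<and> w ! i = x} = {fst p, snd p} \<and> fst p < snd p" if "x \<in> ?V" for x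
  proof -
    have "card {i. i < length w \<and> w ! i = x} = 2"
      using w(2)[OF that] by (simp add: count_list_eq_length_filter length_filter_conv_card eq_commute[of x])
    then obtain a b where "{i. i < length w \<and> w ! i = x} = {a, b}" "a \<noteq> b"
      by (auto simp: card_2_iff)
    then show ?thesis
      by (intro exI[of _ "(min a b, max a b)"]) (auto simp: min_def max_def)
  qed
  then obtain ch where ch: "\<And>x. x \<in> ?V \<Longrightarrow>
      {i. i < length w \<and> w ! i = x} = {fst (ch x), snd (ch x)} \<and> fst (ch x) < snd (ch x)"
    by metis
  have cross: "crossing (ch x) (ch y) \<longleftrightarrow> {x, y} \<in> grid_edges m n"
    if "x \<in> ?V" "y \<in> ?V" "x \<noteq> y" for x y
    using alternate_iff_crossing[of w x "fst (ch x)" "snd (ch x)" y "fst (ch y)" "snd (ch y)"]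
      ch[of x] ch[of y] w(1) that unfolding represents_def by auto
  have nth_ch: "w ! fst (ch x) = x" "w ! snd (ch x) = x" if "x \<in> ?V" for x
  proof -
    have "fst (ch x) \<in> {i. i < length w \<and> w ! i = x}" "snd (ch x) \<in> {i. i < length w \<and> w ! i = x}"
      using ch[OF that] by simp_all
    then show "w ! fst (ch x) = x" "w ! snd (ch x) = x"
      by simp_all
  qed
  have disj: "fst (ch x) \<noteq> fst (ch y) \<and> fst (ch x) \<noteq> snd (ch y)
      \<and> snd (ch x) \<noteq> fst (ch y) \<and> snd (ch x) \<noteq> snd (ch y)"
    if "x \<in> ?V" "y \<in> ?V" "x \<noteq> y" for x y
    using nth_ch[OF that(1)] nth_ch[OF that(2)] that(3) by metis
  have V: "(i, j) \<in> ?V" if "i \<in> {1, 2, 3}" "j \<in> {1, 2, 3}" for i j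
    using that assms by (auto simp: grid_verts_def)
  define \<mu> where "\<mu> p = int (meet (ch (2, 2)) (ch p))" for p
  \<comment> \<open>Used with \<open>t\<close> a corner, \<open>p\<close> and \<open>q\<close> its
    two neighbours, and \<open>r\<close> one of the other two neighbours of the centre.\<close>
  have between: "\<not> (\<mu> p < \<mu> r \<and> \<mu> r < \<mu> q)"
    if "distinct [(2, 2), p, q, r, t]" "{(2, 2), p, q, r, t} \<subseteq> ?V"
      "{(2, 2), p} \<in> grid_edges m n" "{(2, 2), q} \<in> grid_edges m n" "{(2, 2), r} \<in> grid_edges m n"
      "{(2, 2), t} \<notin> grid_edges m n" "{p, q} \<notin> grid_edges m n" "{p, r} \<notin> grid_edges m n"
      "{q, r} \<notin> grid_edges m n" "{t, p} \<in> grid_edges m n" "{t, q} \<in> grid_edges m n"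
      "{t, r} \<notin> grid_edges m n" for p q r t
  proof -
    have "t \<noteq> p" "t \<noteq> q" "t \<noteq> r"
      using that by auto
    then show ?thesis
      unfolding \<mu>_def of_nat_less_iff
      by (intro not_between_if_crossing[where t = "ch t"])
        (use that ch in \<open>simp_all add: cross disj less_imp_neq\<close>)
  qed
  have sides: "\<mu> p \<noteq> \<mu> q" if "p \<in> ?V" "q \<in> ?V" "p \<noteq> q" for p q
    using disj[OF that] by (auto simp: \<mu>_def meet_def)
  let ?N = "(1, 2)" and ?E = "(2, 3)" and ?S = "(3, 2)" and ?W = "(2, 1)"
  note g = grid_edges_iff V
  have
    "\<not> (\<mu> ?N < \<mu> ?S \<and> \<mu> ?S < \<mu> ?E)" "\<not> (\<mu> ?E < \<mu> ?S \<and> \<mu> ?S < \<mu> ?N)"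
    "\<not> (\<mu> ?N < \<mu> ?W \<and> \<mu> ?W < \<mu> ?E)" "\<not> (\<mu> ?E < \<mu> ?W \<and> \<mu> ?W < \<mu> ?N)"
    by (rule between[where t = "(1, 3)"]; simp add: g)+
  moreover have
    "\<not> (\<mu> ?S < \<mu> ?N \<and> \<mu> ?N < \<mu> ?E)" "\<not> (\<mu> ?E < \<mu> ?N \<and> \<mu> ?N < \<mu> ?S)"
    "\<not> (\<mu> ?S < \<mu> ?W \<and> \<mu> ?W < \<mu> ?E)" "\<not> (\<mu> ?E < \<mu> ?W \<and> \<mu> ?W < \<mu> ?S)"
    by (rule between[where t = "(3, 3)"]; simp add: g)+
  moreover have
    "\<not> (\<mu> ?S < \<mu> ?N \<and> \<mu> ?N < \<mu> ?W)" "\<not> (\<mu> ?W < \<mu> ?N \<and> \<mu> ?N < \<mu> ?S)"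
    "\<not> (\<mu> ?S < \<mu> ?E \<and> \<mu> ?E < \<mu> ?W)" "\<not> (\<mu> ?W < \<mu> ?E \<and> \<mu> ?E < \<mu> ?S)"
    by (rule between[where t = "(3, 1)"]; simp add: g)+
  moreover have
    "\<not> (\<mu> ?N < \<mu> ?S \<and> \<mu> ?S < \<mu> ?W)" "\<not> (\<mu> ?W < \<mu> ?S \<and> \<mu> ?S < \<mu> ?N)"
    "\<not> (\<mu> ?N < \<mu> ?E \<and> \<mu> ?E < \<mu> ?W)" "\<not> (\<mu> ?W < \<mu> ?E \<and> \<mu> ?E < \<mu> ?N)"
    by (rule between[where t = "(1, 1)"]; simp add: g)+
  moreover have "\<mu> ?N \<noteq> \<mu> ?E" "\<mu> ?N \<noteq> \<mu> ?S" "\<mu> ?N \<noteq> \<mu> ?W" "\<mu> ?E \<noteq> \<mu> ?S"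
    "\<mu> ?E \<noteq> \<mu> ?W" "\<mu> ?S \<noteq> \<mu> ?W"
    by (rule sides; simp add: V)+
  \<comment> \<open>Four distinct numbers have only three consecutive pairs, but each of the four
    corners demands a different one.\<close>
  ultimately show False
    by smt
qed

text \<open>Letters that occur once each always alternate, so a single non-adjacent pair of vertices
  suffices.\<close>

lemma grid_not_1_representable:
  assumes "m \<ge> 3" and "n \<ge> 3"
  shows "\<not> k_representable 1 (grid_verts m n) (grid_edges m n)"
proof
  assume "k_representable 1 (grid_verts m n) (grid_edges m n)"
  then obtain w where w: "represents w (grid_verts m n) (grid_edges m n)"
      "\<forall>x\<in>grid_verts m n. count_list w x = 1"
    unfolding k_representable_def by blast
  have V: "(1, 1) \<in> grid_verts m n" "(2, 2) \<in> grid_verts m n"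
    using assms by (auto simp: grid_verts_def)
  have "alternate w (1, 1) (2, 2)"
    using w(2) V by (intro alternate_if_count_list_1) auto
  then have "{(1, 1), (2, 2)} \<in> grid_edges m n"
    using w(1) V unfolding represents_def by force
  then show False
    using grid_edges_iff[OF V] by simp
qed

theorem theorem1:
  fixes m n :: nat
  assumes "m \<ge> 3" and "n \<ge> 3"
  shows "representation_number (grid_verts m n) (grid_edges m n) = 3"
proof -
  have "(LEAST k. k \<ge> 1 \<and> k_representable k (grid_verts m n) (grid_edges m n)) = 3"
  proof (rule Least_equality)
    fix k :: nat
    assume k: "k \<ge> 1 \<and> k_representable k (grid_verts m n) (grid_edges m n)"
    then have "k \<noteq> 1" "k \<noteq> 2"
      using grid_not_1_representable[OF assms] grid_not_2_representable[OF assms] by auto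
    then show "3 \<le> k"
      using k by linarith
  qed (simp add: grid_3_representable)
  moreover have "word_representable (grid_verts m n) (grid_edges m n)"
    using grid_3_representable unfolding word_representable_def k_representable_def by blast
  ultimately show ?thesis
    by (simp add: representation_number_def numeral_eq_enat)
qed

end
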